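(* For every positive integer $d$ and every $1>\delta>0$ there is a positive integer $n'$ with the following property: for any $n'$ finite families $\mathcal{F}_1, \mathcal{F}_2, \ldots, \mathcal{F}_{n'}$ of convex sets in $\mathbb{R}^d$ (considered as colour classes), if the intersection $F_1\cap\cdots\cap F_{n'}$ of every colourful choice $F_1 \in \mathcal{F}_1, \ldots, F_{n'} \in \mathcal{F}_{n'}$ has diameter at least one, then there is a colour class $\mathcal{F}_i$ with $\operatorname{diam}\left(\bigcap \mathcal{F}_i\right) \ge 1-\delta$. Moreover, denoting by $n'(\operatorname{diam},d,\delta)$ the smallest such $n'$, we have $n'(\operatorname{diam}, d, \delta) = \Theta_d\left(\delta^{-(d-1)/2}\right)$.
   Context: The diameter $\operatorname{diam}(X)$ of a set $X\subset\mathbb{R}^d$ is the supremum of Euclidean distances between two of its points; the empty set does not have diameter at least any positive number. For a family $\mathcal{F}$ of sets, $\bigcap\mathcal{F}$ is the intersection of all its members (the intersection of an empty family is $\mathbb{R}^d$). $g(d,\delta)=\Theta_d(f(\delta))$ means that for every fixed $d$, $g(d,\delta)=\Theta(f(\delta))$ as $\delta\to 0$, i.e. there are constants $a_d, b_d,\delta_d>0$ depending only on $d$ with $a_d f(\delta)\le g(d,\delta)\le b_d f(\delta)$ for all $0<\delta<\delta_d$. *)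

theory Defs
  imports "HOL-Analysis.Analysis" "HOL-Library.Landau_Symbols"
begin

text \<open>
  The library function \<^const>\<open>diameter\<close> is real-valued, hence unspecified on unbounded sets.
  Here unbounded sets have diameter \<open>\<infinity>\<close>, and the empty set has diameter \<open>0\<close>,
  so it does not have diameter at least any positive number.
\<close>

definition ediam :: "'a::metric_space set \<Rightarrow> ennreal" where
  "ediam X = (SUP (x, y) \<in> X \<times> X. ennreal (dist x y))"

text \<open>
  The dimension is \<open>d = CARD('n)\<close>. A colour class may be empty; then \<open>\<Inter>(F i)\<close> is the
  whole space, of diameter \<open>\<infinity>\<close>.
\<close>

definition colourful_diam_prop :: "'n::finite itself \<Rightarrow> real \<Rightarrow> nat \<Rightarrow> bool" where
  "colourful_diam_prop _ \<delta> n \<longleftrightarrow>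
     (\<forall>F :: nat \<Rightarrow> (real ^ 'n) set set.
        (\<forall>i\<in>{1..n}. finite (F i) \<and> (\<forall>A\<in>F i. convex A)) \<longrightarrow>
        (\<forall>C. (\<forall>i\<in>{1..n}. C i \<in> F i) \<longrightarrow> 1 \<le> ediam (\<Inter>i\<in>{1..n}. C i)) \<longrightarrow>
        (\<exists>i\<in>{1..n}. ennreal (1 - \<delta>) \<le> ediam (\<Inter>(F i))))"

text \<open>Meaningful for \<open>0 < \<delta> < 1\<close>, where some \<open>n\<close> with the property exists.\<close>

definition n_diam :: "'n::finite itself \<Rightarrow> real \<Rightarrow> nat" where
  "n_diam T \<delta> = (LEAST n. 0 < n \<and> colourful_diam_prop T \<delta> n)"

end

theory Submission
  imports Defs
begin

text \<open>
  Upper bound: about \<open>\<delta>\<close> to the power \<open>-(d-1)/2\<close> directions \<open>v\<close> suffice to see every segment with relative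
  loss at most \<open>\<delta>/2\<close>. Having two points \<open>x, y\<close> with \<open>v \<bullet> (x - y) \<ge> 1 - \<delta>\<close> in common is a
  statement about the convex sets \<open>A \<times> A\<close> cut by a half-space of \<open>\<real>\<^sup>2\<^sup>d\<close>, so, if all colour
  classes fail, colourful Helly produces from any \<open>2d + 1\<close> of them a colourful choice of width
  less than \<open>1 - \<delta>\<close> in direction \<open>v\<close>; doing this for all \<open>v\<close> with disjoint groups of colours gives a
  colourful choice of diameter less than one.

  Lower bound: let every colour class consist of the slabs of width \<open>1 - 2\<delta>\<close> orthogonal to the directions of
  such a net, so that the whole class intersects in diameter less than \<open>1 - \<delta>\<close>. A slab destroys
  a centred unit segment only if the two directions are within \<open>O(\<surd>\<delta>)\<close> of each other up to sign; so a packing of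
  directions leaves an intact unit segment whenever there are fewer colours than
  directions in the packing.
\<close>

section \<open>Colourful Helly theorem for finite families of convex sets\<close>

text \<open>Choose the colourful tuple whose point of least norm is as far out as possible. By Helly
  this point is already determined by all colours but one, hence it lies in every member of
  the remaining class.\<close>

theorem colourful_helly_closed:
  fixes K :: "'i \<Rightarrow> 'b \<Rightarrow> 'a::euclidean_space set"
  assumes I: "finite I" "DIM('a) < card I"
    and B: "\<And>i. i \<in> I \<Longrightarrow> finite (B i)"
    and K: "\<And>i a. i \<in> I \<Longrightarrow> a \<in> B i \<Longrightarrow> closed (K i a) \<and> convex (K i a)"
    and ne: "\<And>c. c \<in> PiE I B \<Longrightarrow> (\<Inter>i\<in>I. K i (c i)) \<noteq> {}"
  shows "\<exists>i\<in>I. (\<Inter>a\<in>B i. K i a) \<noteq> {}"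
proof (cases "\<exists>i\<in>I. B i = {}")
  case False
  define S where "S c = (\<Inter>i\<in>I. K i (c i))" for c
  define p where "p c = closest_point (S c) 0" for c
  have fin: "finite (PiE I B)"
    using I B by (simp add: finite_PiE)
  have "PiE I B \<noteq> {}"
    using False by (simp add: PiE_eq_empty_iff)
  then have "Max ((\<lambda>c. norm (p c)) ` PiE I B) \<in> (\<lambda>c. norm (p c)) ` PiE I B"
    using fin by (intro Max_in) auto
  then obtain c where c: "c \<in> PiE I B" "Max ((\<lambda>c. norm (p c)) ` PiE I B) = norm (p c)"
    by blast
  have max: "norm (p c') \<le> norm (p c)" if "c' \<in> PiE I B" for c'
    unfolding c(2)[symmetric] using fin that by (intro Max_ge) auto
  note c = c(1)
  have KI: "closed (K i (c i))" "convex (K i (c i))" if "i \<in> I" for i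
    using K[OF that] c that by (auto simp: PiE_mem)
  have p: "p c' \<in> S c'" "\<And>z. z \<in> S c' \<Longrightarrow> norm (p c') \<le> norm z" if c': "c' \<in> PiE I B" for c'
  proof -
    have "closed (S c')"
      unfolding S_def using K c' by (intro closed_INT ballI) (auto simp: PiE_mem)
    moreover have "S c' \<noteq> {}"
      using ne c' by (simp add: S_def)
    ultimately show "p c' \<in> S c'" "\<And>z. z \<in> S c' \<Longrightarrow> norm (p c') \<le> norm z"
      using closest_point_exists[of "S c'" 0] by (auto simp: p_def)
  qed
  have "\<exists>i\<in>I. \<forall>z \<in> (\<Inter>j\<in>I-{i}. K j (c j)). norm (p c) \<le> norm z"
  proof (rule ccontr)
    assume "\<not> ?thesis"
    then have small: "\<exists>z \<in> (\<Inter>j\<in>I-{i}. K j (c j)). norm z < norm (p c)" if "i \<in> I" for i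
      using that by (meson not_le)
    \<comment> \<open>The open ball joins the family as one more convex set: a common point of all
      of \<open>f\<close> would lie in \<open>S c\<close> and be strictly shorter than
      \<open>p c\<close>.\<close>
    define U where "U = ball (0::'a) (norm (p c))"
    define f where "f = insert U ((\<lambda>i. K i (c i)) ` I)"
    have inter: "\<Inter>t \<noteq> {}" if t: "t \<subseteq> f" "card t \<le> DIM('a) + 1" for t
    proof (cases "U \<in> t")
      case False
      then have "p c \<in> \<Inter>t"
        using t p(1)[OF c] by (auto simp: f_def S_def)
      then show ?thesis by blast
    next
      case True
      have "finite t"
        using t I by (auto simp: f_def intro: finite_subset)
      then have le: "card (t - {U}) \<le> DIM('a)"
        using t True by (simp add: card_Diff_singleton)
      have "t - {U} \<subseteq> (\<lambda>i. K i (c i)) ` I"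
        using t by (auto simp: f_def)
      \<comment> \<open>Different colours may carry the same set, so one index is chosen per set. At
        most \<open>DIM('a)\<close> colours are then used, which leaves a colour \<open>i\<close>
        whose witness \<open>z\<close> lies in all of \<open>t\<close>.\<close>
      then obtain J where J: "J \<subseteq> I" "inj_on (\<lambda>i. K i (c i)) J" "t - {U} = (\<lambda>i. K i (c i)) ` J"
        by (auto simp: subset_image_inj)
      then have "card J < card I"
        using le I by (simp add: card_image)
      then obtain i where i: "i \<in> I" "i \<notin> J"
        using J by (metis less_irrefl subsetI subset_antisym)
      then obtain z where z: "z \<in> (\<Inter>j\<in>I-{i}. K j (c j))" "norm z < norm (p c)"
        using small by blast
      have "z \<in> A" if "A \<in> t" for A
      proof (cases "A = U")
        case False
        then have "A \<in> (\<lambda>i. K i (c i)) ` J"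
          using that J(3) by blast
        then show ?thesis using z i J(1) by auto
      qed (use z in \<open>simp add: U_def\<close>)
      then show ?thesis by blast
    qed
    have "\<Inter>f \<noteq> {}"
    \<comment> \<open>Coincidences may make \<open>f\<close> too small for Helly's theorem; then
      \<open>f\<close> is itself one of the subfamilies covered by \<open>inter\<close>.\<close>
    proof (cases "card f \<ge> DIM('a) + 1")
      case True
      have "\<forall>s\<in>f. convex s"
        using KI by (auto simp: f_def U_def)
      then show ?thesis
        using Helly[OF True] inter by simp
    next
      case False
      then show ?thesis using inter[of f] by simp
    qed
    then obtain z where "z \<in> U" "z \<in> S c"
      by (auto simp: f_def S_def)
    then show False
      using p(2)[OF c] by (fastforce simp: U_def)
  qed
  then obtain i where i: "i \<in> I" and min: "\<And>z. z \<in> (\<Inter>j\<in>I-{i}. K j (c j)) \<Longrightarrow> norm (p c) \<le> norm z"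
    by blast
  let ?T = "\<Inter>j\<in>I-{i}. K j (c j)"
  have "p c \<in> K i a" if a: "a \<in> B i" for a
  proof -
    \<comment> \<open>Changing only colour \<open>i\<close> keeps \<open>p c'\<close> in
      \<open>?T\<close>. There \<open>p c\<close> has least norm, while maximality gives
      \<open>norm (p c') \<le> norm (p c)\<close>; uniqueness of the closest point forces
      equality.\<close>
    define c' where "c' = c(i := a)"
    have c': "c' \<in> PiE I B"
      using c a i by (auto simp: c'_def PiE_iff extensional_def)
    have q': "p c' \<in> K j (c' j)" if "j \<in> I" for j
      using p(1)[OF c'] that by (auto simp: S_def)
    have q: "p c' \<in> K i a"
      using q'[OF i] by (simp add: c'_def)
    have "p c' \<in> K j (c j)" if "j \<in> I - {i}" for j
      using q'[of j] that by (simp add: c'_def)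
    then have qT: "p c' \<in> ?T" by blast
    have "p c \<in> ?T"
      using p(1)[OF c] by (auto simp: S_def)
    moreover have "closed ?T" "convex ?T"
      using KI by (auto intro: closed_INT convex_INT)
    ultimately have "p c = p c'"
      using any_closest_point_unique[of ?T "p c" "p c'" 0] qT min max[OF c'] by fastforce
    then show ?thesis using q by simp
  qed
  then show ?thesis
    using i by blast
qed auto

text \<open>Replacing each set by the convex hull of one chosen point per colourful choice using it
  makes the sets compact.\<close>

corollary colourful_helly:
  fixes K :: "'i \<Rightarrow> 'b \<Rightarrow> 'a::euclidean_space set"
  assumes I: "finite I" "DIM('a) < card I"
    and B: "\<And>i. i \<in> I \<Longrightarrow> finite (B i)"
    and K: "\<And>i a. i \<in> I \<Longrightarrow> a \<in> B i \<Longrightarrow> convex (K i a)"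
    and ne: "\<And>c. c \<in> PiE I B \<Longrightarrow> (\<Inter>i\<in>I. K i (c i)) \<noteq> {}"
  shows "\<exists>i\<in>I. (\<Inter>a\<in>B i. K i a) \<noteq> {}"
proof -
  have "\<forall>c\<in>PiE I B. \<exists>x. x \<in> (\<Inter>i\<in>I. K i (c i))"
    using ne by blast
  from bchoice[OF this] obtain q where q: "\<forall>c\<in>PiE I B. q c \<in> (\<Inter>i\<in>I. K i (c i))" ..
  define L where "L i a = convex hull (q ` {c \<in> PiE I B. c i = a})" for i a
  have sub: "L i a \<subseteq> K i a" if "i \<in> I" "a \<in> B i" for i a
    unfolding L_def using that q K by (intro hull_minimal) auto
  have "finite (PiE I B)"
    using I B by (simp add: finite_PiE)
  then have "closed (L i a) \<and> convex (L i a)" for i a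
    by (auto simp: L_def intro!: compact_imp_closed finite_imp_compact_convex_hull)
  moreover have "(\<Inter>i\<in>I. L i (c i)) \<noteq> {}" if "c \<in> PiE I B" for c
  proof -
    have "q c \<in> (\<Inter>i\<in>I. L i (c i))"
      unfolding L_def using that by (intro INT_I hull_inc) auto
    then show ?thesis by blast
  qed
  ultimately have "\<exists>i\<in>I. (\<Inter>a\<in>B i. L i a) \<noteq> {}"
    using I B by (intro colourful_helly_closed) auto
  then show ?thesis
    using sub by fastforce
qed

section \<open>Nets and packings of directions on the unit sphere\<close>

lemma inverse_sqrt_power:
  assumes "0 < \<delta>" "0 < n"
  shows "(1 / sqrt \<delta>) ^ (n - 1) = \<delta> powr (- (real n - 1) / 2)"
proof -
  have "1 / sqrt \<delta> = \<delta> powr (- 1 / 2)"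
    using assms by (simp add: powr_half_sqrt[symmetric] powr_minus_divide)
  then have "(1 / sqrt \<delta>) ^ (n - 1) = \<delta> powr (real (n - 1) * (- 1 / 2))"
    using assms by (simp add: powr_realpow[symmetric] powr_powr mult.commute)
  also have "real (n - 1) * (- 1 / 2) = - (real n - 1) / 2"
    using assms by (simp add: of_nat_diff field_simps)
  finally show ?thesis .
qed

text \<open>Unnormalised directions on a face of the cube, shared by the net and the packing;
  \<open>sgn\<close> projects them to the sphere.\<close>

definition grid_point :: "'n::finite \<Rightarrow> real \<Rightarrow> ('n \<Rightarrow> int) \<Rightarrow> real ^ 'n" where
  "grid_point i \<epsilon> k = (\<chi> j. if j = i then 1 else \<epsilon> * of_int (k j))"

lemma norm_grid_point_ge_1: "1 \<le> norm (grid_point i \<epsilon> k)"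
  using component_le_norm_cart[of "grid_point i \<epsilon> k" i] by (simp add: grid_point_def)

lemma norm_le_sqrt_card:
  fixes x :: "real ^ 'n"
  assumes "\<And>j. \<bar>x $ j\<bar> \<le> b"
  shows "norm x \<le> sqrt (CARD('n)) * b"
proof -
  have b: "0 \<le> b" using assms[of undefined] by linarith
  have "(\<Sum>j\<in>UNIV. (x $ j)\<^sup>2) \<le> (\<Sum>j\<in>(UNIV::'n set). b\<^sup>2)"
    using assms by (intro sum_mono) (metis abs_le_square_iff abs_of_nonneg b)
  then have "norm x \<le> sqrt (real CARD('n) * b\<^sup>2)"
    by (simp add: norm_vec_def L2_set_def)
  then show ?thesis using b by (simp add: real_sqrt_mult)
qed

text \<open>Expand \<open>(norm (x - y))\<^sup>2\<close> and bound the sum of the squared norms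
  below by twice their product. The loss is quadratic in \<open>r\<close>, which is why mesh of
  order \<surd>\<delta> suffices and the exponent is halved.\<close>

lemma inner_ge_of_close:
  fixes x y :: "'a::real_inner"
  assumes "1 \<le> norm x" "1 \<le> norm y" "norm (x - y) \<le> r"
  shows "(1 - r\<^sup>2 / 2) * norm x \<le> sgn y \<bullet> x"
proof -
  have "(norm x - norm y)\<^sup>2 \<ge> 0" by simp
  moreover have "(norm (x - y))\<^sup>2 = (norm x)\<^sup>2 + (norm y)\<^sup>2 - 2 * (y \<bullet> x)"
    by (simp add: power2_norm_eq_inner inner_diff inner_commute)
  moreover have "(norm (x - y))\<^sup>2 \<le> r\<^sup>2"
    using assms(3) by (simp add: power_mono)
  ultimately have "norm x * norm y - r\<^sup>2 / 2 \<le> y \<bullet> x"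
    by (simp add: power2_diff)
  moreover have "r\<^sup>2 / 2 * 1 \<le> r\<^sup>2 / 2 * (norm x * norm y)"
    using mult_mono[of 1 "norm x" 1 "norm y"] assms by (intro mult_left_mono) auto
  ultimately have "(1 - r\<^sup>2 / 2) * norm x * norm y \<le> y \<bullet> x"
    by (simp add: algebra_simps)
  moreover have "0 < norm y" using assms by linarith
  ultimately show ?thesis
    by (simp add: sgn_div_norm field_simps)
qed

text \<open>Scaling \<open>x\<close> by its largest coordinate \<open>i\<close> puts it on the face \<open>x\<^sub>i = 1\<close> of the cube;
  a grid of mesh \<open>\<epsilon>\<close> on that face only loses a factor \<open>1 - O(\<epsilon>\<^sup>2)\<close> in the inner product.\<close>

lemma direction_net:
  fixes \<delta> :: real
  assumes \<delta>: "0 < \<delta>" "\<delta> \<le> 1"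
  obtains V :: "(real ^ 'n) set" where "finite V" "V \<noteq> {}"
    "real (card V) \<le> CARD('n) * (4 * sqrt CARD('n)) ^ (CARD('n) - 1) * \<delta> powr (- (real CARD('n) - 1) / 2)"
    "\<And>v. v \<in> V \<Longrightarrow> norm v = 1"
    "\<And>x. \<exists>v\<in>V. (1 - \<delta>) * norm x \<le> \<bar>v \<bullet> x\<bar>"
proof -
  define d where "d = CARD('n)"
  have d: "0 < d" by (simp add: d_def)
  \<comment> \<open>Chosen so that an error of \<epsilon> in each of the \<open>d\<close>
    coordinates is a Euclidean error of at most \<surd>\<delta>.\<close>
  define \<epsilon> where "\<epsilon> = sqrt (\<delta> / d)"
  have \<epsilon>: "0 < \<epsilon>" "\<epsilon> \<le> 1"
    using \<delta> d by (auto simp: \<epsilon>_def)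
  define m where "m = \<lfloor>1 / \<epsilon>\<rfloor>"
  have m: "1 \<le> m"
    using \<epsilon> by (simp add: m_def le_floor_iff)
  \<comment> \<open>The extra index \<open>-m-1\<close> is needed because the floor of a negative
    quotient rounds away from zero. Leaving out coordinate \<open>i\<close> gives the exponent
    \<open>d - 1\<close>.\<close>
  define P where "P i = PiE (UNIV - {i::'n}) (\<lambda>_. {-m-1..m})" for i
  define V where "V = (\<Union>i. (sgn \<circ> grid_point i \<epsilon>) ` P i)"
  have finP: "finite (P i)" for i
    by (simp add: P_def finite_PiE)
  have cardP: "real (card (P i)) \<le> (4 / \<epsilon>) ^ (d - 1)" for i
  proof -
    have "card (P i) = nat (2 * m + 2) ^ (d - 1)"
      by (simp add: P_def card_PiE d_def card_Diff_singleton add.commute)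
    moreover have "real (nat (2 * m + 2)) \<le> 4 / \<epsilon>"
    proof -
      have "2 * real_of_int m \<le> 2 / \<epsilon>"
        using mult_left_mono[OF of_int_floor_le[of "1 / \<epsilon>"], of 2] by (simp add: m_def)
      moreover have "2 \<le> 2 / \<epsilon>"
        using \<epsilon> by (simp add: field_simps)
      moreover have "real (nat (2 * m + 2)) = 2 * real_of_int m + 2"
        using m by simp
      ultimately show ?thesis by linarith
    qed
    ultimately show ?thesis
      by (simp add: power_mono)
  qed
  have "finite V"
    using finP by (simp add: V_def)
  moreover have "real (card V) \<le> d * (4 * sqrt d) ^ (d - 1) * \<delta> powr (- (real d - 1) / 2)"
  proof -
    have "card V \<le> (\<Sum>i\<in>UNIV. card (P i))"
      unfolding V_def
      by (intro order.trans[OF card_UN_le] sum_mono card_image_le finP) auto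
    then have "real (card V) \<le> (\<Sum>i\<in>UNIV. real (card (P i)))"
      by (metis of_nat_le_iff of_nat_sum)
    also have "\<dots> \<le> (\<Sum>i\<in>(UNIV::'n set). (4 / \<epsilon>) ^ (d - 1))"
      by (intro sum_mono cardP)
    also have "\<dots> = d * (4 / \<epsilon>) ^ (d - 1)"
      by (simp add: d_def)
    also have "4 / \<epsilon> = 4 * sqrt d * (1 / sqrt \<delta>)"
      by (simp add: \<epsilon>_def real_sqrt_divide)
    also have "(4 * sqrt d * (1 / sqrt \<delta>)) ^ (d - 1) = (4 * sqrt d) ^ (d - 1) * \<delta> powr (- (real d - 1) / 2)"
      using \<delta> d by (simp only: power_mult_distrib[of "4 * sqrt d"] inverse_sqrt_power)
    finally show ?thesis
      by (simp only: mult.assoc)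
  qed
  moreover have "norm v = 1" if "v \<in> V" for v
  proof -
    obtain i k where "v = sgn (grid_point i \<epsilon> k)"
      using \<open>v \<in> V\<close> by (auto simp: V_def)
    then show ?thesis
      using norm_grid_point_ge_1[of i \<epsilon> k] by (auto simp: norm_sgn)
  qed
  moreover have net: "\<exists>v\<in>V. (1 - \<delta>) * norm x \<le> \<bar>v \<bullet> x\<bar>" if "x \<noteq> 0" for x
  proof -
    obtain i where i: "\<And>j. \<bar>x $ j\<bar> \<le> \<bar>x $ i\<bar>"
    proof -
      have "Max (range (\<lambda>j. \<bar>x $ j\<bar>)) \<in> range (\<lambda>j. \<bar>x $ j\<bar>)"
        by (rule Max_in) auto
      then obtain i where "Max (range (\<lambda>j. \<bar>x $ j\<bar>)) = \<bar>x $ i\<bar>" by blast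
      then show thesis
        using that[of i] Max_ge[of "range (\<lambda>j. \<bar>x $ j\<bar>)"] by auto
    qed
    have xi: "x $ i \<noteq> 0"
    proof
      assume "x $ i = 0"
      then have "x = 0" using i by (simp add: vec_eq_iff)
      with \<open>x \<noteq> 0\<close> show False by simp
    qed
    \<comment> \<open>The divisor may be negative, so the direction of \<open>x\<close> is captured
      only up to sign; hence the absolute value in the conclusion.\<close>
    define y where "y = (1 / x $ i) *\<^sub>R x"
    have yi: "y $ i = 1" and yj: "\<bar>y $ j\<bar> \<le> 1" for j
      using xi i[of j] by (auto simp: y_def field_simps)
    define k where "k = restrict (\<lambda>j. \<lfloor>y $ j / \<epsilon>\<rfloor>) (UNIV - {i})"
    have "\<lfloor>y $ j / \<epsilon>\<rfloor> \<in> {-m-1..m}" for j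
    proof -
      have "y $ j / \<epsilon> \<le> 1 / \<epsilon>" "- (1 / \<epsilon>) \<le> y $ j / \<epsilon>"
        using yj[of j] \<epsilon> by (auto simp: field_simps)
      then show ?thesis
        unfolding m_def by (auto intro: floor_mono) linarith
    qed
    then have "k \<in> P i"
      by (auto simp: P_def k_def)
    then have V: "sgn (grid_point i \<epsilon> k) \<in> V"
      by (auto simp: V_def)
    have "\<bar>(y - grid_point i \<epsilon> k) $ j\<bar> \<le> \<epsilon>" for j
    proof (cases "j = i")
      case False
      have "\<bar>y $ j / \<epsilon> - \<lfloor>y $ j / \<epsilon>\<rfloor>\<bar> * \<epsilon> \<le> 1 * \<epsilon>"
        using \<epsilon> by (intro mult_right_mono) linarith+
      then have "\<bar>(y $ j / \<epsilon> - \<lfloor>y $ j / \<epsilon>\<rfloor>) * \<epsilon>\<bar> \<le> \<epsilon>"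
        using \<epsilon> by (simp add: abs_mult)
      then show ?thesis
        using False \<epsilon> by (simp add: grid_point_def k_def algebra_simps)
    qed (use yi \<epsilon> in \<open>simp add: grid_point_def\<close>)
    then have "norm (y - grid_point i \<epsilon> k) \<le> sqrt \<delta>"
      using norm_le_sqrt_card[of "y - grid_point i \<epsilon> k" \<epsilon>] d
      by (simp add: \<epsilon>_def d_def real_sqrt_divide)
    moreover have "1 \<le> norm y"
      using component_le_norm_cart[of y i] yi by simp
    ultimately have "(1 - \<delta> / 2) * norm y \<le> sgn (grid_point i \<epsilon> k) \<bullet> y"
      using inner_ge_of_close[of y "grid_point i \<epsilon> k" "sqrt \<delta>"] norm_grid_point_ge_1 \<delta> by auto
    moreover have "(1 - \<delta>) * norm y \<le> (1 - \<delta> / 2) * norm y"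
      using \<delta> by (intro mult_right_mono) auto
    ultimately have "\<bar>x $ i\<bar> * ((1 - \<delta>) * norm y) \<le> \<bar>x $ i\<bar> * \<bar>sgn (grid_point i \<epsilon> k) \<bullet> y\<bar>"
      by (intro mult_left_mono) auto
    then have "(1 - \<delta>) * norm x \<le> \<bar>sgn (grid_point i \<epsilon> k) \<bullet> x\<bar>"
      using xi by (simp add: y_def)
    then show ?thesis using V by blast
  qed
  moreover have "V \<noteq> {}"
    using net[of "axis undefined 1"] by (auto simp: axis_eq_0_iff)
  ultimately show thesis
    using that[of V] by (metis d_def ex_in_conv inner_zero_right abs_zero norm_zero mult_zero_right order_refl)
qed

text \<open>A unit vector \<open>w\<close> with
  \<open>1 - 2 * \<delta> < \<bar>w \<bullet> v\<bar>\<close> is within 2\<surd>\<delta> of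
  \<open>v\<close> or \<open>-v\<close>. Taking all directions in one orthant excludes opposite
  signs for two of them, so they would be closer than 4\<surd>\<delta>, less than the grid permits
  for distinct points.\<close>

lemma direction_packing:
  fixes \<delta> :: real
  assumes \<delta>: "0 < \<delta>" "\<delta> \<le> 1 / 8"
  obtains W :: "(real ^ 'n) set" where "finite W"
    "(1 / (8 * sqrt CARD('n))) ^ (CARD('n) - 1) * \<delta> powr (- (real CARD('n) - 1) / 2) \<le> real (card W)"
    "\<And>w. w \<in> W \<Longrightarrow> norm w = 1"
    "\<And>w w' v. w \<in> W \<Longrightarrow> w' \<in> W \<Longrightarrow> norm v = 1 \<Longrightarrow> 1 - 2 * \<delta> < \<bar>w \<bullet> v\<bar> \<Longrightarrow>
       1 - 2 * \<delta> < \<bar>w' \<bullet> v\<bar> \<Longrightarrow> w = w'"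
proof -
  define d where "d = CARD('n)"
  have d: "0 < d" by (simp add: d_def)
  obtain i :: 'n where True by blast
  \<comment> \<open>The mesh absorbs two errors of 4\<surd>\<delta> and the factor
    \<open>sqrt d\<close> that normalisation can cost.\<close>
  define \<epsilon> where "\<epsilon> = 8 * sqrt d * sqrt \<delta>"
  have \<epsilon>: "0 < \<epsilon>"
    using \<delta> d by (auto simp: \<epsilon>_def)
  define m where "m = \<lfloor>1 / \<epsilon>\<rfloor>"
  have m: "0 \<le> m" "\<epsilon> * m \<le> 1" "1 / \<epsilon> \<le> m + 1"
  proof -
    show "0 \<le> m"
      using \<epsilon> by (simp add: m_def)
    have "\<epsilon> * m \<le> \<epsilon> * (1 / \<epsilon>)"
      using \<epsilon> by (intro mult_left_mono) (auto simp: m_def)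
    then show "\<epsilon> * m \<le> 1"
      using \<epsilon> by simp
    show "1 / \<epsilon> \<le> m + 1"
      unfolding m_def by linarith
  qed
  \<comment> \<open>Only nonnegative indices, so that all directions have pairwise nonnegative inner
    products.\<close>
  define P where "P = PiE (UNIV - {i}) (\<lambda>_. {0..m})"
  define w where "w k = sgn (grid_point i \<epsilon> k)" for k
  define t where "t k = 1 / norm (grid_point i \<epsilon> k)" for k
  have wi: "w k $ i = t k" and wj: "j \<noteq> i \<Longrightarrow> w k $ j = t k * (\<epsilon> * k j)" for k j
    by (auto simp: w_def t_def grid_point_def sgn_div_norm divide_inverse)
  have norm_w: "norm (w k) = 1" for k
    using norm_grid_point_ge_1[of i \<epsilon> k] by (auto simp: w_def norm_sgn)
  have kP: "0 \<le> \<epsilon> * k j" "\<epsilon> * k j \<le> 1" if "k \<in> P" "j \<noteq> i" for k j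
  proof -
    have "k j \<in> {0..m}"
      using PiE_mem[OF that(1)[unfolded P_def], of j] that(2) by simp
    then have kj: "0 \<le> real_of_int (k j)" "real_of_int (k j) \<le> m" by simp_all
    show "0 \<le> \<epsilon> * k j"
      using kj \<epsilon> by (intro mult_nonneg_nonneg) auto
    have "\<epsilon> * k j \<le> \<epsilon> * m"
      using kj \<epsilon> by (intro mult_left_mono) auto
    then show "\<epsilon> * k j \<le> 1"
      using m(2) by (rule order.trans)
  qed
  have t: "0 < t k" "1 / sqrt d \<le> t k" if "k \<in> P" for k
  proof -
    have "norm (grid_point i \<epsilon> k) \<le> sqrt d * 1"
      unfolding d_def using kP[OF that] by (intro norm_le_sqrt_card) (auto simp: grid_point_def)
    moreover have "0 < norm (grid_point i \<epsilon> k)"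
      using norm_grid_point_ge_1[of i \<epsilon> k] by linarith
    ultimately show "0 < t k" "1 / sqrt d \<le> t k"
      by (simp_all add: t_def frac_le)
  qed
  have sep: "k = k'" if k: "k \<in> P" "k' \<in> P" and close: "norm (w k - w k') < 4 * sqrt \<delta>" for k k'
  proof (rule PiE_ext)
    show "k \<in> PiE (UNIV - {i}) (\<lambda>_. {0..m})" "k' \<in> PiE (UNIV - {i}) (\<lambda>_. {0..m})"
      using k by (auto simp: P_def)
  next
    fix j assume j: "j \<in> UNIV - {i}"
    have comp: "\<bar>w k $ j - w k' $ j\<bar> < 4 * sqrt \<delta>" for j
      using component_le_norm_cart[of "w k - w k'" j] close by simp
    have 1: "\<bar>t k * (\<epsilon> * k j) - t k' * (\<epsilon> * k' j)\<bar> < 4 * sqrt \<delta>" "\<bar>t k' - t k\<bar> < 4 * sqrt \<delta>"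
      using comp[of j] comp[of i] j by (auto simp: wi wj)
    have 2: "\<bar>t k' - t k\<bar> * (\<epsilon> * k' j) \<le> \<bar>t k' - t k\<bar> * 1"
      using kP[OF k(2)] j by (intro mult_left_mono) auto
    \<comment> \<open>The two points are normalised by different factors. Coordinate
      \<open>i\<close> of \<open>w k\<close> is \<open>t k\<close> itself, so closeness there
      controls the difference of the factors.\<close>
    have "t k * (\<epsilon> * (k j - k' j))
        = (t k * (\<epsilon> * k j) - t k' * (\<epsilon> * k' j)) + (t k' - t k) * (\<epsilon> * k' j)"
      by (simp add: algebra_simps)
    also have "\<bar>\<dots>\<bar> \<le> \<bar>t k * (\<epsilon> * k j) - t k' * (\<epsilon> * k' j)\<bar> + \<bar>(t k' - t k) * (\<epsilon> * k' j)\<bar>"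
      by (rule abs_triangle_ineq)
    also have "\<bar>(t k' - t k) * (\<epsilon> * k' j)\<bar> = \<bar>t k' - t k\<bar> * (\<epsilon> * k' j)"
      using kP(1)[OF k(2), of j] j by (simp only: abs_mult[of "t k' - t k"] abs_of_nonneg) simp
    also have "\<bar>t k * (\<epsilon> * k j) - t k' * (\<epsilon> * k' j)\<bar> + \<bar>t k' - t k\<bar> * (\<epsilon> * k' j)
        \<le> \<bar>t k * (\<epsilon> * k j) - t k' * (\<epsilon> * k' j)\<bar> + \<bar>t k' - t k\<bar>"
      using 2 by simp
    also have "\<dots> < 8 * sqrt \<delta>"
      using add_strict_mono[OF 1] by simp
    finally have "\<bar>t k * (\<epsilon> * (k j - k' j))\<bar> < 8 * sqrt \<delta>" .
    then have "t k * (\<epsilon> * \<bar>k j - k' j\<bar>) < 8 * sqrt \<delta>"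
      using t(1)[OF k(1)] \<epsilon> by (simp add: abs_mult)
    moreover have "1 / sqrt d * (\<epsilon> * \<bar>k j - k' j\<bar>) \<le> t k * (\<epsilon> * \<bar>k j - k' j\<bar>)"
      using t(2)[OF k(1)] \<epsilon> by (intro mult_right_mono) auto
    moreover have "1 / sqrt d * (\<epsilon> * \<bar>k j - k' j\<bar>) = 8 * sqrt \<delta> * \<bar>k j - k' j\<bar>"
      using d by (simp add: \<epsilon>_def)
    ultimately have "8 * sqrt \<delta> * \<bar>k j - k' j\<bar> < 8 * sqrt \<delta> * 1"
      by linarith
    then have "real_of_int \<bar>k j - k' j\<bar> < 1"
      using \<delta> by (subst (asm) mult_less_cancel_left_pos) auto
    then show "k j = k' j" by linarith
  qed
  have inj: "inj_on w P"
    using sep \<delta> by (auto intro!: inj_onI)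
  have pos: "0 \<le> w k \<bullet> w k'" if k: "k \<in> P" "k' \<in> P" for k k'
  proof -
    have nonneg: "0 \<le> w k $ j" if "k \<in> P" for k j
      using t(1)[OF that] kP(1)[OF that, of j] by (cases "j = i") (auto simp: wi wj)
    show ?thesis
      unfolding inner_vec_def using nonneg k by (auto intro!: sum_nonneg)
  qed
  have near: "\<exists>s\<in>{-1, 1}. norm (w k - s *\<^sub>R v) < 2 * sqrt \<delta>"
    if v: "norm v = 1" "1 - 2 * \<delta> < \<bar>w k \<bullet> v\<bar>" for k v
  proof -
    \<comment> \<open>With this sign the squared distance is
      \<open>2 - 2 * \<bar>w k \<bullet> v\<bar>\<close>, which is less than 4\<delta>.\<close>
    define s :: real where "s = (if w k \<bullet> v < 0 then -1 else 1)"
    have "(norm (w k - s *\<^sub>R v))\<^sup>2 = (norm (w k))\<^sup>2 + (norm v)\<^sup>2 - 2 * \<bar>w k \<bullet> v\<bar>"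
      by (auto simp: power2_norm_eq_inner inner_diff inner_add inner_commute s_def)
    also have "\<dots> < (2 * sqrt \<delta>)\<^sup>2"
      using v norm_w[of k] \<delta> by (simp add: power_mult_distrib)
    finally have "norm (w k - s *\<^sub>R v) < 2 * sqrt \<delta>"
      by (rule power2_less_imp_less) (use \<delta> in simp)
    moreover have "s \<in> {-1, 1}" by (simp add: s_def)
    ultimately show ?thesis by blast
  qed
  show thesis
  proof (rule that[of "w ` P"])
    show "finite (w ` P)"
      by (simp add: P_def finite_PiE)
    show "norm x = 1" if "x \<in> w ` P" for x
      using that norm_w by auto
    show "(1 / (8 * sqrt CARD('n))) ^ (CARD('n) - 1) * \<delta> powr (- (real CARD('n) - 1) / 2) \<le> real (card (w ` P))"
    proof -
      have "(1 / (8 * sqrt d)) ^ (d - 1) * \<delta> powr (- (real d - 1) / 2) = (1 / \<epsilon>) ^ (d - 1)"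
      proof -
        have "1 / \<epsilon> = 1 / (8 * sqrt d) * (1 / sqrt \<delta>)"
          by (simp add: \<epsilon>_def)
        then show ?thesis
          using \<delta> d by (simp only: power_mult_distrib[of "1 / (8 * sqrt d)"] inverse_sqrt_power)
      qed
      also have "\<dots> \<le> (real_of_int (m + 1)) ^ (d - 1)"
        using m \<epsilon> by (intro power_mono) auto
      also have "\<dots> = real (card P)"
        using m by (simp add: P_def card_PiE d_def card_Diff_singleton)
      finally show ?thesis
        using inj by (simp add: card_image d_def)
    qed
    show "x = x'" if "x \<in> w ` P" "x' \<in> w ` P" and v: "norm v = 1" "1 - 2 * \<delta> < \<bar>x \<bullet> v\<bar>" "1 - 2 * \<delta> < \<bar>x' \<bullet> v\<bar>"
      for x x' v
    proof -
      obtain k k' where k: "k \<in> P" "k' \<in> P" "x = w k" "x' = w k'"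
        using \<open>x \<in> w ` P\<close> \<open>x' \<in> w ` P\<close> by auto
      obtain s s' where s: "s \<in> {-1, 1}" "norm (w k - s *\<^sub>R v) < 2 * sqrt \<delta>"
        and s': "s' \<in> {-1, 1}" "norm (w k' - s' *\<^sub>R v) < 2 * sqrt \<delta>"
        using near v k by metis
      \<comment> \<open>Opposite signs would make the squared norm of \<open>w k + w k'\<close> less
        than 16\<delta>, hence less than 2 as \<delta> is at most 1/8; nonnegative inner products
        make it at least 2.\<close>
      have "s = s'"
      proof (rule ccontr)
        assume "s \<noteq> s'"
        then have "s' = - s" using s s' by auto
        then have "norm (w k + w k') < 4 * sqrt \<delta>"
          using norm_triangle_ineq[of "w k - s *\<^sub>R v" "w k' - s' *\<^sub>R v"] s s' by simp
        then have "(norm (w k + w k'))\<^sup>2 < (4 * sqrt \<delta>)\<^sup>2"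
          by (intro power_strict_mono) auto
        also have "\<dots> = 16 * \<delta>"
          using \<delta> by (simp add: power_mult_distrib)
        finally have "(norm (w k + w k'))\<^sup>2 < 16 * \<delta>" .
        moreover have "(norm (w k + w k'))\<^sup>2 = (norm (w k))\<^sup>2 + (norm (w k'))\<^sup>2 + 2 * (w k \<bullet> w k')"
          by (simp add: power2_norm_eq_inner inner_add inner_commute)
        moreover have "0 \<le> w k \<bullet> w k'"
          using pos k by blast
        ultimately show False
          using norm_w[of k] norm_w[of k'] \<delta> by simp
      qed
      then have "norm (w k - w k') < 4 * sqrt \<delta>"
        using norm_triangle_ineq4[of "w k - s *\<^sub>R v" "w k' - s' *\<^sub>R v"] s s' by simp
      then show ?thesis using sep[OF k(1,2)] k(3,4) by simp
    qed
  qed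
qed

section \<open>Diameter estimates and the upper bound on the number of colours\<close>

lemma ediam_leI:
  assumes "\<And>x y. x \<in> X \<Longrightarrow> y \<in> X \<Longrightarrow> dist x y \<le> r"
  shows "ediam X \<le> ennreal r"
  unfolding ediam_def using assms by (auto intro!: SUP_least ennreal_leI)

lemma ediam_geI:
  assumes "x \<in> X" "y \<in> X" "r \<le> dist x y"
  shows "ennreal r \<le> ediam X"
  unfolding ediam_def using assms by (intro SUP_upper2[of "(x, y)"]) (auto intro: ennreal_leI)

lemma ediam_UNIV: "ennreal r \<le> ediam (UNIV :: (real ^ 'n) set)"
  by (rule ediam_geI[of 0 _ "r *\<^sub>R axis undefined 1"]) (auto simp: norm_axis_1)

text \<open>Each net direction gets its own \<open>2 * CARD('n) + 1\<close> colours, one more than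
  the dimension of the space of pairs \<open>(x, y)\<close>, as colourful Helly requires.\<close>

lemma colourful_diam_prop_of_net:
  fixes V :: "(real ^ 'n) set"
  assumes \<delta>: "0 < \<delta>" "\<delta> < 1"
    and V: "finite V" "\<And>v. v \<in> V \<Longrightarrow> norm v = 1"
    and net: "\<And>x. \<exists>v\<in>V. (1 - \<delta> / 2) * norm x \<le> \<bar>v \<bullet> x\<bar>"
  shows "colourful_diam_prop TYPE('n) \<delta> (card V * (2 * CARD('n) + 1))"
  unfolding colourful_diam_prop_def
proof (intro allI impI)
  define D where "D = 2 * CARD('n)"
  define n where "n = card V * (D + 1)"
  fix F :: "nat \<Rightarrow> (real ^ 'n) set set"
  assume F: "\<forall>i\<in>{1..card V * (2 * CARD('n) + 1)}. finite (F i) \<and> (\<forall>A\<in>F i. convex A)"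
    and diam: "\<forall>C. (\<forall>i\<in>{1..card V * (2 * CARD('n) + 1)}. C i \<in> F i) \<longrightarrow>
      1 \<le> ediam (\<Inter>i\<in>{1..card V * (2 * CARD('n) + 1)}. C i)"
  have "\<exists>i\<in>{1..n}. ennreal (1 - \<delta>) \<le> ediam (\<Inter>(F i))"
  proof (rule ccontr)
    assume "\<not> ?thesis"
    then have small: "\<not> ennreal (1 - \<delta>) \<le> ediam (\<Inter>(F i))" if "i \<in> {1..n}" for i
      using that by blast
    \<comment> \<open>The first component of \<open>b i\<close> is the direction to which colour
      \<open>i\<close> is assigned.\<close>
    obtain b where b: "bij_betw b {1..n} (V \<times> {..D})"
      using finite_same_card_bij[of "{1..n}" "V \<times> {..D}"] V by (auto simp: n_def)
    define G where "G v = {i \<in> {1..n}. fst (b i) = v}" for v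
    have "\<exists>c\<in>PiE (G v) F. \<forall>x\<in>(\<Inter>i\<in>G v. c i). \<forall>y\<in>(\<Inter>i\<in>G v. c i). v \<bullet> (x - y) < 1 - \<delta>"
      if v: "v \<in> V" for v
    proof (rule ccontr)
      assume contra: "\<not> ?thesis"
      \<comment> \<open>Convex in the product space; a common point of these sets is a pair of
        common points of the sets \<open>A\<close> that is long in direction
        \<open>v\<close>.\<close>
      define K where "K A = (A \<times> A) \<inter> {z. 1 - \<delta> \<le> v \<bullet> (fst z - snd z)}" for A :: "(real ^ 'n) set"
      have "bij_betw b (G v) ({v} \<times> {..D})"
        unfolding bij_betw_def
      proof
        show "inj_on b (G v)"
          using b by (auto simp: bij_betw_def G_def intro: inj_on_subset)
        show "b ` G v = {v} \<times> {..D}"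
        proof -
          have im: "b ` {1..n} = V \<times> {..D}" using b by (simp add: bij_betw_def)
          have "b ` G v = {z \<in> b ` {1..n}. fst z = v}" by (auto simp: G_def)
          also have "\<dots> = {v} \<times> {..D}" unfolding im using v by auto
          finally show ?thesis .
        qed
      qed
      then have cardG: "card (G v) = D + 1"
        using bij_betw_same_card by fastforce
      have half: "convex {z :: (real ^ 'n) \<times> (real ^ 'n). 1 - \<delta> \<le> v \<bullet> (fst z - snd z)}"
      proof -
        have "{z. 1 - \<delta> \<le> v \<bullet> (fst z - snd z)} = {z. 1 - \<delta> \<le> (v, - v) \<bullet> z}"
          by (auto simp: inner_diff_right inner_prod_def)
        then show ?thesis
          using convex_halfspace_ge[of "1 - \<delta>" "(v, - v)"] by simp
      qed
      have "\<exists>i\<in>G v. (\<Inter>A\<in>F i. K A) \<noteq> {}"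
      proof (rule colourful_helly)
        show "finite (G v)" by (simp add: G_def)
        show "DIM((real ^ 'n) \<times> (real ^ 'n)) < card (G v)"
          by (simp add: cardG D_def)
        show "finite (F i)" if "i \<in> G v" for i
          using F that by (auto simp: G_def n_def D_def)
        show "convex (K A)" if "i \<in> G v" "A \<in> F i" for i A
          unfolding K_def using F that half
          by (intro convex_Int convex_Times) (auto simp: G_def n_def D_def)
        show "(\<Inter>i\<in>G v. K (c i)) \<noteq> {}" if c: "c \<in> PiE (G v) F" for c
        proof -
          obtain x y where "x \<in> (\<Inter>i\<in>G v. c i)" "y \<in> (\<Inter>i\<in>G v. c i)" "1 - \<delta> \<le> v \<bullet> (x - y)"
            using contra c by (meson not_le)
          then have "(x, y) \<in> (\<Inter>i\<in>G v. K (c i))"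
            by (auto simp: K_def)
          then show ?thesis by blast
        qed
      qed
      then obtain i x y where i: "i \<in> G v" and xy: "(x, y) \<in> (\<Inter>A\<in>F i. K A)"
        by (metis ex_in_conv surj_pair)
      have "ennreal (1 - \<delta>) \<le> ediam (\<Inter>(F i))"
      \<comment> \<open>Colourful Helly says nothing useful for an empty class, whose intersection
        is the whole space.\<close>
      proof (cases "F i = {}")
        case True
        then show ?thesis using ediam_UNIV by simp
      next
        case False
        then have mem: "x \<in> \<Inter>(F i)" "y \<in> \<Inter>(F i)" and w: "1 - \<delta> \<le> v \<bullet> (x - y)"
          using xy by (auto simp: K_def)
        have "v \<bullet> (x - y) \<le> dist x y"
          using norm_cauchy_schwarz[of v "x - y"] V(2)[OF v] by (simp add: dist_norm)
        then show ?thesis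
          using mem w by (intro ediam_geI[of x _ y]) auto
      qed
      then show False
        using small i by (simp add: G_def)
    qed
    then obtain c where c: "\<And>v. v \<in> V \<Longrightarrow> c v \<in> PiE (G v) F"
      and narrow: "\<And>v x y. v \<in> V \<Longrightarrow> x \<in> (\<Inter>i\<in>G v. c v i) \<Longrightarrow> y \<in> (\<Inter>i\<in>G v. c v i) \<Longrightarrow>
        v \<bullet> (x - y) < 1 - \<delta>"
      by metis
    \<comment> \<open>The groups partition the colours, so the narrow choices for the separate
      directions glue to one choice that is narrow in all of them.\<close>
    define C where "C i = c (fst (b i)) i" for i
    have "C i \<in> F i" if i: "i \<in> {1..n}" for i
    proof -
      have "b i \<in> V \<times> {..D}"
        using bij_betwE[OF b] i by blast
      then show ?thesis
        using c[of "fst (b i)"] i by (auto simp: C_def G_def PiE_def Pi_def mem_Times_iff)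
    qed
    then have "1 \<le> ediam (\<Inter>i\<in>{1..n}. C i)"
      using diam by (auto simp: n_def D_def)
    \<comment> \<open>Taking the net at \<delta>/2 instead of \<delta> is what makes this quotient
      strictly less than 1.\<close>
    also have "\<dots> \<le> ennreal ((1 - \<delta>) / (1 - \<delta> / 2))"
    proof (rule ediam_leI)
      fix x y assume xy: "x \<in> (\<Inter>i\<in>{1..n}. C i)" "y \<in> (\<Inter>i\<in>{1..n}. C i)"
      obtain v where v: "v \<in> V" "(1 - \<delta> / 2) * norm (x - y) \<le> \<bar>v \<bullet> (x - y)\<bar>"
        using net by blast
      have "x \<in> (\<Inter>i\<in>G v. c v i)" "y \<in> (\<Inter>i\<in>G v. c v i)"
        using xy by (auto simp: C_def G_def)
      then have "v \<bullet> (x - y) < 1 - \<delta>" "v \<bullet> (y - x) < 1 - \<delta>"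
        using narrow v by auto
      then have "\<bar>v \<bullet> (x - y)\<bar> < 1 - \<delta>"
        by (simp add: inner_diff_right)
      then show "dist x y \<le> (1 - \<delta>) / (1 - \<delta> / 2)"
        using v \<delta> by (simp add: dist_norm pos_le_divide_eq mult.commute)
    qed
    also have "\<dots> < ennreal 1"
      using \<delta> by (intro ennreal_lessI) (auto simp: field_simps)
    finally show False by simp
  qed
  then show "\<exists>i\<in>{1..card V * (2 * CARD('n) + 1)}. ennreal (1 - \<delta>) \<le> ediam (\<Inter>(F i))"
    by (simp add: n_def D_def)
qed

section \<open>The lower bound on the number of colours\<close>

text \<open>All classes are the same family of slabs around a net. By the packing property each
  chosen slab rules out at most one direction of \<open>W\<close>, so by pigeonhole \<open>n\<close>
  slabs spare one.\<close>

lemma not_colourful_diam_prop_of_packing: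
  fixes W :: "(real ^ 'n) set"
  assumes \<delta>: "0 < \<delta>" "\<delta> \<le> 1 / 8"
    and W: "finite W" "\<And>w. w \<in> W \<Longrightarrow> norm w = 1"
    and packing: "\<And>w w' v. w \<in> W \<Longrightarrow> w' \<in> W \<Longrightarrow> norm v = 1 \<Longrightarrow> 1 - 2 * \<delta> < \<bar>w \<bullet> v\<bar> \<Longrightarrow>
       1 - 2 * \<delta> < \<bar>w' \<bullet> v\<bar> \<Longrightarrow> w = w'"
    and n: "n < card W"
  shows "\<not> colourful_diam_prop TYPE('n) \<delta> n"
proof
  assume holds: "colourful_diam_prop TYPE('n) \<delta> n"
  obtain V :: "(real ^ 'n) set" where V: "finite V" "V \<noteq> {}" "\<And>v. v \<in> V \<Longrightarrow> norm v = 1"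
    and net: "\<And>x. \<exists>v\<in>V. (1 - \<delta>) * norm x \<le> \<bar>v \<bullet> x\<bar>"
    by (rule direction_net[of \<delta>]) (use \<delta> in auto)
  define h where "h = (1 - 2 * \<delta>) / 2"
  define slab where "slab v = {x :: real ^ 'n. \<bar>v \<bullet> x\<bar> \<le> h}" for v
  have "convex (slab v)" for v
  proof -
    have "slab v = {x. v \<bullet> x \<le> h} \<inter> {x. v \<bullet> x \<ge> - h}"
      by (auto simp: slab_def)
    then show ?thesis
      by (simp add: convex_Int convex_halfspace_le convex_halfspace_ge)
  qed
  then have "\<forall>i\<in>{1..n}. finite (slab ` V) \<and> (\<forall>A\<in>slab ` V. convex A)"
    using V by auto
  moreover have "1 \<le> ediam (\<Inter>i\<in>{1..n}. C i)" if C: "\<forall>i\<in>{1..n}. C i \<in> slab ` V" for C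
  proof -
    have "\<forall>i\<in>{1..n}. \<exists>u. u \<in> V \<and> C i = slab u"
      using C by blast
    from bchoice[OF this] obtain u where u: "\<forall>i\<in>{1..n}. u i \<in> V \<and> C i = slab (u i)" ..
    obtain w where w: "w \<in> W" "\<And>i. i \<in> {1..n} \<Longrightarrow> \<bar>w \<bullet> u i\<bar> \<le> 1 - 2 * \<delta>"
    proof (rule ccontr)
      assume "\<not> thesis"
      then have "\<forall>w\<in>W. \<exists>i. i \<in> {1..n} \<and> 1 - 2 * \<delta> < \<bar>w \<bullet> u i\<bar>"
        using that by (meson not_le)
      from bchoice[OF this] obtain f
        where f: "\<forall>w\<in>W. f w \<in> {1..n} \<and> 1 - 2 * \<delta> < \<bar>w \<bullet> u (f w)\<bar>" ..
      have "inj_on f W"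
      proof (rule inj_onI)
        fix w w' assume w: "w \<in> W" "w' \<in> W" "f w = f w'"
        then have "norm (u (f w)) = 1"
          using f u V(3) by blast
        moreover have "1 - 2 * \<delta> < \<bar>w \<bullet> u (f w)\<bar>"
          using f w(1) by blast
        moreover have "1 - 2 * \<delta> < \<bar>w' \<bullet> u (f w)\<bar>"
          unfolding w(3) using f w(2) by blast
        ultimately show "w = w'"
          by (rule packing[OF w(1,2)])
      qed
      moreover have "f ` W \<subseteq> {1..n}"
        using f by blast
      ultimately have "card W \<le> card {1..n}"
        by (intro card_inj_on_le) auto
      then show False using n by simp
    qed
    \<comment> \<open>The bound on \<open>\<bar>w \<bullet> u i\<bar>\<close> is twice the
      half-width \<open>h\<close>, so the centred unit segment along \<open>w\<close> fits in every
      chosen slab.\<close>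
    have "(1 / 2) *\<^sub>R w \<in> C i" "(- 1 / 2) *\<^sub>R w \<in> C i" if "i \<in> {1..n}" for i
      using bspec[OF u that] w(2)[OF that] by (auto simp: slab_def h_def inner_commute)
    moreover have "dist ((1 / 2) *\<^sub>R w) ((- 1 / 2) *\<^sub>R w) = 1"
      using W(2)[OF w(1)] by (simp add: dist_norm scaleR_left_diff_distrib[symmetric])
    ultimately have "ennreal 1 \<le> ediam (\<Inter>i\<in>{1..n}. C i)"
      by (intro ediam_geI[of "(1 / 2) *\<^sub>R w" _ "(- 1 / 2) *\<^sub>R w"]) auto
    then show ?thesis by simp
  qed
  ultimately have "\<exists>i\<in>{1..n}. ennreal (1 - \<delta>) \<le> ediam (\<Inter>(slab ` V))"
    using holds unfolding colourful_diam_prop_def by (elim allE[of _ "\<lambda>_. slab ` V"]) blast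
  then have "ennreal (1 - \<delta>) \<le> ediam (\<Inter>(slab ` V))"
    by blast
  also have "\<dots> \<le> ennreal ((1 - 2 * \<delta>) / (1 - \<delta>))"
  proof (rule ediam_leI)
    fix x y assume xy: "x \<in> \<Inter>(slab ` V)" "y \<in> \<Inter>(slab ` V)"
    obtain v where v: "v \<in> V" "(1 - \<delta>) * norm (x - y) \<le> \<bar>v \<bullet> (x - y)\<bar>"
      using net by blast
    have "\<bar>v \<bullet> x\<bar> \<le> h" "\<bar>v \<bullet> y\<bar> \<le> h"
      using xy v by (auto simp: slab_def)
    then have "\<bar>v \<bullet> x - v \<bullet> y\<bar> \<le> 2 * h"
      by linarith
    then have "\<bar>v \<bullet> (x - y)\<bar> \<le> 1 - 2 * \<delta>"
      by (simp add: inner_diff_right h_def)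
    then show "dist x y \<le> (1 - 2 * \<delta>) / (1 - \<delta>)"
      using v \<delta> by (simp add: dist_norm pos_le_divide_eq mult.commute)
  qed
  also have "\<dots> < ennreal (1 - \<delta>)"
  proof (rule ennreal_lessI)
    have "(1 - \<delta>) * (1 - \<delta>) = 1 - 2 * \<delta> + \<delta> * \<delta>"
      by (simp add: algebra_simps)
    then show "(1 - 2 * \<delta>) / (1 - \<delta>) < 1 - \<delta>"
      using \<delta> by (simp add: pos_divide_less_eq)
  qed (use \<delta> in auto)
  finally show False by simp
qed

section \<open>Existence and order of growth of \<open>n_diam\<close>\<close>

theorem theorem3p1:
  shows "(\<forall>\<delta>. 0 < \<delta> \<and> \<delta> < 1 \<longrightarrow> (\<exists>n>0. colourful_diam_prop TYPE('n::finite) \<delta> n)) \<and>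
         (\<lambda>\<delta>. real (n_diam TYPE('n) \<delta>)) \<in> \<Theta>[at_right 0](\<lambda>\<delta>. \<delta> powr (- (real CARD('n) - 1) / 2))"
proof -
  define d where "d = CARD('n)"
  have d: "0 < d" by (simp add: d_def)
  \<comment> \<open>The power of \<open>1 / 2\<close> comes from using the net at \<delta>/2, and
    \<open>2 * real d + 1\<close> counts the colours per direction.\<close>
  define b where "b = (2 * real d + 1) * (d * (4 * sqrt d) ^ (d - 1) * (1 / 2) powr (- (real d - 1) / 2))"
  define a where "a = (1 / (8 * sqrt d)) ^ (d - 1)"
  have upper: "\<exists>n>0. colourful_diam_prop TYPE('n) \<delta> n \<and> real n \<le> b * \<delta> powr (- (real d - 1) / 2)"
    if \<delta>: "0 < \<delta>" "\<delta> < 1" for \<delta>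
  proof -
    obtain V :: "(real ^ 'n) set" where V: "finite V" "V \<noteq> {}" "\<And>v. v \<in> V \<Longrightarrow> norm v = 1"
      and card: "real (card V) \<le> d * (4 * sqrt d) ^ (d - 1) * (\<delta> / 2) powr (- (real d - 1) / 2)"
      and net: "\<And>x. \<exists>v\<in>V. (1 - \<delta> / 2) * norm x \<le> \<bar>v \<bullet> x\<bar>"
      by (rule direction_net[where 'n = 'n and \<delta> = "\<delta> / 2", folded d_def]) (use \<delta> in auto)
    have "real (card V * (2 * d + 1)) \<le> (2 * real d + 1) * (d * (4 * sqrt d) ^ (d - 1) * (\<delta> / 2) powr (- (real d - 1) / 2))"
      unfolding of_nat_mult using mult_left_mono[OF card, of "2 * real d + 1"] by (simp add: mult.commute add.commute)
    also have "\<dots> = b * \<delta> powr (- (real d - 1) / 2)"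
      using \<delta> powr_mult[of "1 / 2" \<delta> "- (real d - 1) / 2"] by (simp add: b_def)
    finally show ?thesis
      using colourful_diam_prop_of_net[OF \<delta> V(1,3) net] V(1,2)
      by (intro exI[of _ "card V * (2 * d + 1)"]) (auto simp: d_def card_gt_0_iff)
  qed
  have n_diam: "colourful_diam_prop TYPE('n) \<delta> (n_diam TYPE('n) \<delta>)"
    "real (n_diam TYPE('n) \<delta>) \<le> b * \<delta> powr (- (real d - 1) / 2)"
    if \<delta>: "0 < \<delta>" "\<delta> < 1" for \<delta>
  proof -
    obtain n where n: "0 < n \<and> colourful_diam_prop TYPE('n) \<delta> n"
      "real n \<le> b * \<delta> powr (- (real d - 1) / 2)"
      using upper[OF \<delta>] by blast
    show "colourful_diam_prop TYPE('n) \<delta> (n_diam TYPE('n) \<delta>)"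
      unfolding n_diam_def
      using LeastI[of "\<lambda>n. 0 < n \<and> colourful_diam_prop TYPE('n) \<delta> n", OF n(1)] by blast
    have "n_diam TYPE('n) \<delta> \<le> n"
      unfolding n_diam_def by (rule Least_le) (fact n(1))
    then show "real (n_diam TYPE('n) \<delta>) \<le> b * \<delta> powr (- (real d - 1) / 2)"
      using n(2) by linarith
  qed
  have lower: "a * \<delta> powr (- (real d - 1) / 2) \<le> real (n_diam TYPE('n) \<delta>)"
    if \<delta>: "0 < \<delta>" "\<delta> \<le> 1 / 8" for \<delta>
  proof -
    obtain W :: "(real ^ 'n) set" where W: "finite W"
      and card: "a * \<delta> powr (- (real d - 1) / 2) \<le> real (card W)"
      and unit: "\<And>w. w \<in> W \<Longrightarrow> norm w = 1"
      and packing: "\<And>w w' v. w \<in> W \<Longrightarrow> w' \<in> W \<Longrightarrow> norm v = 1 \<Longrightarrow> 1 - 2 * \<delta> < \<bar>w \<bullet> v\<bar> \<Longrightarrow>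
       1 - 2 * \<delta> < \<bar>w' \<bullet> v\<bar> \<Longrightarrow> w = w'"
      by (rule direction_packing[where 'n = 'n, OF \<delta>, folded d_def, folded a_def]) (rule that)
    have "card W \<le> n_diam TYPE('n) \<delta>"
    proof (rule leI, rule notI)
      assume "n_diam TYPE('n) \<delta> < card W"
      with \<delta> W unit packing have "\<not> colourful_diam_prop TYPE('n) \<delta> (n_diam TYPE('n) \<delta>)"
        by (rule not_colourful_diam_prop_of_packing)
      then show False
        using n_diam(1)[of \<delta>] \<delta> by simp
    qed
    then show ?thesis using card by linarith
  qed
  have "(\<lambda>\<delta>. real (n_diam TYPE('n) \<delta>)) \<in> \<Theta>[at_right 0](\<lambda>\<delta>. \<delta> powr (- (real d - 1) / 2))"
  proof (rule bigthetaI')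
    show "0 < a" "0 < b"
      using d by (simp_all add: a_def b_def)
    show "\<forall>\<^sub>F \<delta> in at_right 0. a * norm (\<delta> powr (- (real d - 1) / 2)) \<le> norm (real (n_diam TYPE('n) \<delta>)) \<and>
        norm (real (n_diam TYPE('n) \<delta>)) \<le> b * norm (\<delta> powr (- (real d - 1) / 2))"
    proof (rule eventually_at_rightI[of 0 "1 / 8"])
      fix \<delta> :: real assume "\<delta> \<in> {0<..<1 / 8}"
      then show "a * norm (\<delta> powr (- (real d - 1) / 2)) \<le> norm (real (n_diam TYPE('n) \<delta>)) \<and>
          norm (real (n_diam TYPE('n) \<delta>)) \<le> b * norm (\<delta> powr (- (real d - 1) / 2))"
        using lower[of \<delta>] n_diam(2)[of \<delta>] by simp
    qed simp
  qed
  then show ?thesis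
    using upper by (auto simp: d_def)
qed

end
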